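(* Let $C>0$ and $y_0>0$, and for $k\in\mathbb{R}$ let $$H_1(k)=C\begin{pmatrix}\cosh y_0-\cos k & 1-\cos(k-iy_0)\\ 1-\cos(k+iy_0) & \cosh y_0-\cos k\end{pmatrix}.$$ Then $H_1$ is a two-band ($n=2$) Hermitian Bloch Hamiltonian of hopping range $m=1$ such that: (i) every matrix element of $H_1(k)$ is a linear combination of $e^{ik}$, $1$ and $e^{-ik}$; (ii) the eigenvalues of $H_1(k)$ are $E_f=0$ (a flat band) and $E_1(k)=2C(\cosh y_0-\cos k)>0$ (a dispersive band), so the flat band is isolated; (iii) the quantum metric length of the flat band is $\ell_{QM}=\frac14\coth y_0$, and the pole of the flat-band projection $P_f$ in the upper half plane closest to the real axis has imaginary part $y_{\min}=y_0$, so that the inequality $\ell_{QM}\le\frac{N^2}{4}\coth y_{\min}$ holds with equality for $N=(n-1)m=1$.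
   Context: $P_f(k)$ is the orthogonal projection of $\mathbb{C}^2$ onto $\ker H_1(k)$ for real $k$, extended meromorphically to complex $k$ (its entries are rational functions of $e^{ik}$). The quantum metric of the flat band is $\mathcal{G}(k)=\frac12\mathrm{Tr}[(\partial_kP_f(k))^2]$ and the quantum metric length is $\ell_{QM}=\int_0^{2\pi}\frac{dk}{2\pi}\mathcal{G}(k)$. For a tight-binding Hamiltonian with $n$ bands and hopping range $m$, $N=(n-1)m$. *)

theory Defs
  imports "HOL-Complex_Analysis.Complex_Analysis"
begin

definition coth :: "real \<Rightarrow> real" where
  "coth y = cosh y / sinh y"

section \<open>Hermitian matrices, spectra and orthogonal projections\<close>

definition hermitian :: "complex^'n^'n \<Rightarrow> bool" where
  "hermitian A \<longleftrightarrow> (\<forall>i j. A $ j $ i = cnj (A $ i $ j))"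

definition eigenspace :: "complex^'n^'n \<Rightarrow> complex \<Rightarrow> (complex^'n) set" where
  "eigenspace A \<mu> = {v. A *v v = \<mu> *s v}"

definition eigenvalues :: "complex^'n^'n \<Rightarrow> complex set" where
  "eigenvalues A = {\<mu>. \<exists>v. v \<noteq> 0 \<and> A *v v = \<mu> *s v}"

definition ker :: "complex^'n^'n \<Rightarrow> (complex^'n) set" where
  "ker A = {v. A *v v = 0}"

(* The inner product of the library on complex^'n is only its real part. *)
definition cinner :: "complex^'n \<Rightarrow> complex^'n \<Rightarrow> complex" where
  "cinner u v = (\<Sum>i\<in>UNIV. cnj (u $ i) * v $ i)"

definition is_orth_projection :: "complex^'n^'n \<Rightarrow> (complex^'n) set \<Rightarrow> bool" where
  "is_orth_projection P V \<longleftrightarrow>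
     (\<forall>v. P *v v \<in> V \<and> (\<forall>w\<in>V. cinner w (v - P *v v) = 0))"

definition orth_projection :: "(complex^'n) set \<Rightarrow> complex^'n^'n" where
  "orth_projection V = (THE P. is_orth_projection P V)"

section \<open>Bloch Hamiltonians and their bands\<close>

definition bloch_hamiltonian :: "(real \<Rightarrow> complex^'n^'n) \<Rightarrow> bool" where
  "bloch_hamiltonian H \<longleftrightarrow> (\<forall>k. hermitian (H k)) \<and> (\<forall>k. H (k + 2 * pi) = H k)"

definition hops_within :: "(real \<Rightarrow> complex^'n^'n) \<Rightarrow> nat \<Rightarrow> bool" where
  "hops_within H m \<longleftrightarrow>
     (\<exists>t :: int \<Rightarrow> complex^'n^'n. \<forall>k i j.
        H k $ i $ j = (\<Sum>l = - int m..int m. t l $ i $ j * exp (\<i> * of_int l * of_real k)))"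

definition hopping_range :: "(real \<Rightarrow> complex^'n^'n) \<Rightarrow> nat" where
  "hopping_range H = (LEAST m. hops_within H m)"

definition number_of_bands :: "(real \<Rightarrow> complex^'n^'n) \<Rightarrow> nat" where
  "number_of_bands H = CARD('n)"

definition N_bound :: "(real \<Rightarrow> complex^'n^'n) \<Rightarrow> nat" where
  "N_bound H = (number_of_bands H - 1) * hopping_range H"

(* A band that is non-degenerate and uniformly separated from the rest of the spectrum. *)
definition isolated_band :: "(real \<Rightarrow> complex^'n^'n) \<Rightarrow> (real \<Rightarrow> real) \<Rightarrow> bool" where
  "isolated_band H E \<longleftrightarrow>
     (\<forall>k. vec.dim (eigenspace (H k) (of_real (E k))) = 1) \<and>
     (\<exists>\<delta>>0. \<forall>k. \<forall>\<mu>\<in>eigenvalues (H k) - {of_real (E k)}. \<delta> \<le> cmod (\<mu> - of_real (E k)))"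

section \<open>Flat-band projection, quantum metric and poles\<close>

(* The energy of the flat band is normalised to 0, so its eigenspace is the kernel. *)
definition flat_projection :: "(real \<Rightarrow> complex^'n^'n) \<Rightarrow> real \<Rightarrow> complex^'n^'n" where
  "flat_projection H k = orth_projection (ker (H k))"

(* The metric and its length are kept complex-valued, as the trace is. *)
definition quantum_metric :: "(real \<Rightarrow> complex^'n^'n) \<Rightarrow> real \<Rightarrow> complex" where
  "quantum_metric P k =
     1/2 * trace (vector_derivative P (at k) ** vector_derivative P (at k))"

definition qm_length :: "(real \<Rightarrow> complex^'n^'n) \<Rightarrow> complex" where
  "qm_length P = integral {0..2 * pi} (\<lambda>k. quantum_metric P k / of_real (2 * pi))"

(* By the identity theorem two such extensions agree off a closed discrete set,
   hence have the same poles (is_pole only looks at punctured neighbourhoods). *)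
definition is_meromorphic_extension ::
  "(real \<Rightarrow> complex^'n^'n) \<Rightarrow> (complex \<Rightarrow> complex^'n^'n) \<Rightarrow> bool" where
  "is_meromorphic_extension P Pc \<longleftrightarrow>
     (\<forall>k::real. Pc (of_real k) = P k) \<and>
     (\<forall>i j. (\<lambda>z. Pc z $ i $ j) meromorphic_on UNIV)"

definition rational_in_exp :: "(complex \<Rightarrow> complex^'n^'n) \<Rightarrow> bool" where
  "rational_in_exp Pc \<longleftrightarrow>
     (\<forall>i j. \<exists>p q :: complex poly. q \<noteq> 0 \<and>
        (\<forall>z. Pc z $ i $ j = poly p (exp (\<i> * z)) / poly q (exp (\<i> * z))))"

definition upper_pole :: "(real \<Rightarrow> complex^'n^'n) \<Rightarrow> complex \<Rightarrow> bool" where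
  "upper_pole P z \<longleftrightarrow> 0 < Im z \<and>
     (\<exists>Pc. is_meromorphic_extension P Pc \<and> (\<exists>i j. is_pole (\<lambda>w. Pc w $ i $ j) z))"

definition y_min :: "(real \<Rightarrow> complex^'n^'n) \<Rightarrow> real" where
  "y_min P = Inf (Im ` {z. upper_pole P z})"

section \<open>The Hamiltonian\<close>

definition H1 :: "real \<Rightarrow> real \<Rightarrow> real \<Rightarrow> complex^2^2" where
  "H1 C y0 k =
     (let c = complex_of_real C; y = complex_of_real y0; x = complex_of_real k in
      vector [vector [c * (cosh y - cos x),        c * (1 - cos (x - \<i> * y))],
              vector [c * (1 - cos (x + \<i> * y)),   c * (cosh y - cos x)]])"

end

theory Submission
  imports Defs
begin

text \<open>With \<open>u = exp (\<i> z)\<close>, \<open>q = exp (- y)\<close> and \<open>D z = cosh y - cos z\<close>, the off-diagonal entries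
  of the Hamiltonian are \<open>C\<close> times perfect squares, up to units, \<open>1 - cos (z - \<i> y) = - (u - q)\<^sup>2 / (2 q u)\<close>, and \<open>D\<close>
  factors as \<open>- (u - q) (u - 1/q) / (2 u)\<close>. Hence they equal \<open>C D f\<close> and \<open>C D / f\<close> for the Blaschke
  factor \<open>f = (u - q) / (q u - 1)\<close>, which is unimodular on the real axis. So \<open>H1\<close> has rank one,
  and the flat-band projection has off-diagonal entries \<open>- f / 2\<close> and \<open>- 1 / (2 f)\<close>, whose only
  poles in the upper half plane are the solutions of \<open>u = q\<close>. Since
  \<open>f' / f = \<i> sinh y / D\<close> is a multiple of the Poisson kernel, the quantum metric is
  \<open>sinh\<^sup>2 y / (4 D\<^sup>2)\<close>, which has an elementary primitive on all of \<open>[0, 2 \<pi>]\<close>.\<close>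

section \<open>Derivatives, poles and a Poisson integral\<close>

text \<open>Limits in a finite product are componentwise. Applied twice, this reduces
  differentiating a matrix-valued function to differentiating its entries.\<close>

lemma has_vector_derivative_vec:
  fixes f :: "real \<Rightarrow> 'a::real_normed_vector ^ 'n"
  assumes "\<And>i. ((\<lambda>x. f x $ i) has_vector_derivative f' $ i) (at x within S)"
  shows "(f has_vector_derivative f') (at x within S)"
  unfolding has_vector_derivative_def has_derivative_def
proof (intro conjI vec_tendstoI)
  show "bounded_linear (\<lambda>h. h *\<^sub>R f')"
    by (rule bounded_linear_scaleR_left)
  show "((\<lambda>y. ((f y - f (Lim (at x within S) (\<lambda>x. x)) -
      (y - Lim (at x within S) (\<lambda>x. x)) *\<^sub>R f') /\<^sub>R
      norm (y - Lim (at x within S) (\<lambda>x. x))) $ i) \<longlongrightarrow> 0 $ i) (at x within S)" for i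
    using assms[of i] unfolding has_vector_derivative_def has_derivative_def by simp
qed

text \<open>Inversion flips the sign of a logarithmic derivative. This form keeps the two
  off-diagonal entries \<open>- f / 2\<close> and \<open>- (1 / f) / 2\<close> in step.\<close>

lemma has_vector_derivative_inverse_logarithmic:
  fixes f :: "real \<Rightarrow> 'a::real_normed_field"
  assumes "(f has_vector_derivative r * f k) (at k within S)" "f k \<noteq> 0"
  shows "((\<lambda>k. 1 / f k) has_vector_derivative - r / f k) (at k within S)"
  using assms unfolding has_vector_derivative_def
  by (auto intro!: derivative_eq_intros simp: field_simps)

text \<open>Identity theorem for meromorphic functions. Since \<open>upper_pole\<close> admits any
  meromorphic extension, it lets the poles be read off one explicit extension.\<close>

lemma is_pole_iff_if_eq_on_Reals:
  fixes f g :: "complex \<Rightarrow> complex"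
  assumes "f meromorphic_on UNIV" "g meromorphic_on UNIV"
    and eq: "\<And>k::real. f (of_real k) = g (of_real k)"
  shows "is_pole f z \<longleftrightarrow> is_pole g z"
proof -
  have "(\<lambda>w. f w - g w) meromorphic_on UNIV" by (intro meromorphic_intros assms)
  from meromorphic_imp_constant_or_avoid[OF this open_UNIV connected_UNIV, of 0]
  have "(\<forall>\<^sub>\<approx>w\<in>UNIV. f w - g w = 0) \<or> (\<forall>\<^sub>\<approx>w\<in>UNIV. f w - g w \<noteq> 0)" by simp
  \<comment> \<open>The real axis accumulates at 0, so the difference has zeros in every punctured
    neighbourhood of 0.\<close>
  moreover have "\<not> (\<forall>\<^sub>\<approx>w\<in>UNIV. f w - g w \<noteq> 0)"
  proof
    assume "\<forall>\<^sub>\<approx>w\<in>UNIV. f w - g w \<noteq> 0"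
    then have "\<forall>\<^sub>F w in at 0. f w - g w \<noteq> 0" by (simp add: eventually_cosparse_open_eq)
    moreover have "filterlim (\<lambda>k. complex_of_real k) (at 0) (at 0)"
      by (intro filterlim_atI) (auto intro!: tendsto_eq_intros simp: eventually_at_filter)
    ultimately have "\<forall>\<^sub>F k in at (0::real). f (of_real k) - g (of_real k) \<noteq> 0"
      by (rule eventually_compose_filterlim)
    then show False by (simp add: eq)
  qed
  ultimately have "\<forall>\<^sub>\<approx>w\<in>UNIV. f w - g w = 0" by blast
  then have "\<forall>\<^sub>F w in at z. f w = g w" by (simp add: eventually_cosparse_open_eq)
  then show ?thesis by (intro is_pole_cong) auto
qed

section \<open>Integrating the square of the Poisson kernel\<close>

lemma cosh_gt_1: "y \<noteq> 0 \<Longrightarrow> 1 < cosh (y::real)"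
  using cosh_real_ge_1[of y] cosh_real_one_iff[of y] by linarith

lemma cosh_minus_cos_pos: "y > 0 \<Longrightarrow> 0 < cosh y - cos (k::real)"
  using cosh_gt_1[of y] cos_le_one[of k] by linarith

lemma cosh_of_real: "cosh (complex_of_real y) = of_real (cosh y)"
  by (simp add: cosh_field_def flip: exp_of_real)

lemma sinh_of_real: "sinh (complex_of_real y) = of_real (sinh y)"
  by (simp add: sinh_field_def flip: exp_of_real)

text \<open>The second summand is the continuous primitive of the Poisson kernel \<open>sinh y / (cosh y - cos k)\<close>;
  the usual half-angle primitive jumps at \<open>k = \<pi>\<close>.\<close>
lemma poisson_square_antideriv:
  fixes y k :: real
  assumes "y > 0"
  shows "((\<lambda>k. sin k / (cosh y - cos k) + cosh y / sinh y * (k + 2 * arctan (exp (- y) * sin k / (1 - exp (- y) * cos k))))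
     has_real_derivative (sinh y)\<^sup>2 / (cosh y - cos k)\<^sup>2) (at k within S)"
proof -
  define q where "q = exp (- y)"
  have q: "0 < q" "q < 1" using assms by (auto simp: q_def)
  have B: "1 - q * cos k > 0"
  proof -
    have "q * cos k \<le> q * 1" using q by (intro mult_left_mono) auto
    then show ?thesis using q by linarith
  qed
  have D: "0 < cosh y - cos k" by (rule cosh_minus_cos_pos[OF assms])
  have ch: "cosh y = (1 + q^2) / (2*q)" "sinh y = (1 - q^2) / (2*q)"
    using q by (simp_all add: cosh_field_def sinh_field_def q_def exp_minus field_simps power2_eq_square)
  have D': "1 + q\<^sup>2 - 2 * q * cos k > 0"
  proof -
    have "1 + q\<^sup>2 - 2 * q * cos k = 2 * q * (cosh y - cos k)"
      using q by (simp add: ch field_simps)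
    then show ?thesis using D q by simp
  qed
  \<comment> \<open>This is the squared modulus of \<open>1 - q * exp (\<i> * k)\<close>, which also
    equals \<open>2 * q * (cosh y - cos k)\<close>.\<close>
  have ne: "(1 - q * cos k)\<^sup>2 + (q * sin k)\<^sup>2 = 1 + q\<^sup>2 - 2 * q * cos k"
    using sin_cos_squared_add3[of k] by algebra
  \<comment> \<open>The arctan is minus the argument of \<open>1 - q * exp (\<i> * k)\<close>. It
    has no jumps because the real part \<open>1 - q * cos k\<close> stays positive.\<close>
  have "((\<lambda>k. arctan (q * sin k / (1 - q * cos k))) has_real_derivative
      (q * cos k - q\<^sup>2) / (1 + q\<^sup>2 - 2 * q * cos k)) (at k within S)"
  proof -
    have "((\<lambda>k. arctan (q * sin k / (1 - q * cos k))) has_real_derivative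
       inverse (1 + (q * sin k / (1 - q * cos k))\<^sup>2) *
       ((q * cos k * (1 - q * cos k) - q * sin k * (q * sin k)) / ((1 - q * cos k) * (1 - q * cos k))))
        (at k within S)"
      using B by (auto intro!: derivative_eq_intros)
    moreover have "inverse (1 + (a / b)\<^sup>2) * (n / (b * b)) = n / (b\<^sup>2 + a\<^sup>2)"
      if "b \<noteq> 0" for a b n :: real
    proof -
      have "1 + (a / b)\<^sup>2 = (b\<^sup>2 + a\<^sup>2) / b\<^sup>2" using that by (simp add: field_simps)
      then show ?thesis using that by (simp add: power2_eq_square)
    qed
    from this[of "1 - q * cos k" "q * sin k" "q * cos k * (1 - q * cos k) - q * sin k * (q * sin k)"]
    have "inverse (1 + (q * sin k / (1 - q * cos k))\<^sup>2) *
       ((q * cos k * (1 - q * cos k) - q * sin k * (q * sin k)) / ((1 - q * cos k) * (1 - q * cos k))) =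
       (q * cos k * (1 - q * cos k) - q * sin k * (q * sin k)) / ((1 - q * cos k)\<^sup>2 + (q * sin k)\<^sup>2)"
      using B by simp
    moreover have "q * cos k * (1 - q * cos k) - q * sin k * (q * sin k) = q * cos k - q\<^sup>2"
      using sin_cos_squared_add3[of k] by algebra
    ultimately show ?thesis by (simp add: ne)
  qed
  then have "((\<lambda>k. k + 2 * arctan (q * sin k / (1 - q * cos k))) has_real_derivative
      1 + 2 * ((q * cos k - q\<^sup>2) / (1 + q\<^sup>2 - 2 * q * cos k))) (at k within S)"
    by (intro DERIV_add DERIV_ident DERIV_cmult)
  also have "1 + 2 * ((q * cos k - q\<^sup>2) / (1 + q\<^sup>2 - 2 * q * cos k)) = sinh y / (cosh y - cos k)"
    using q D D' by (simp add: ch divide_simps)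
  finally have *: "((\<lambda>k. k + 2 * arctan (q * sin k / (1 - q * cos k))) has_real_derivative
      sinh y / (cosh y - cos k)) (at k within S)" .
  have "((\<lambda>k. sin k / (cosh y - cos k)) has_real_derivative
     (cosh y * cos k - 1) / (cosh y - cos k)\<^sup>2) (at k within S)"
    using D by (auto intro!: derivative_eq_intros simp: power2_eq_square) (simp add: algebra_simps)
  then have "((\<lambda>k. sin k / (cosh y - cos k) + cosh y / sinh y * (k + 2 * arctan (q * sin k / (1 - q * cos k))))
     has_real_derivative (cosh y * cos k - 1) / (cosh y - cos k)\<^sup>2 +
       cosh y / sinh y * (sinh y / (cosh y - cos k))) (at k within S)"
    by (intro DERIV_add DERIV_cmult *)
  \<comment> \<open>Over the common denominator the terms \<open>cosh y * cos k\<close> cancel,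
    leaving \<open>(cosh y)\<^sup>2 - 1\<close> as numerator.\<close>
  also have "(cosh y * cos k - 1) / (cosh y - cos k)\<^sup>2 + cosh y / sinh y * (sinh y / (cosh y - cos k)) =
       (sinh y)\<^sup>2 / (cosh y - cos k)\<^sup>2"
    using D assms by (simp add: sinh_square_eq divide_simps) (simp add: algebra_simps power2_eq_square)
  finally show ?thesis unfolding q_def .
qed

text \<open>At both endpoints the sine and arctan terms of the primitive vanish, so only its linear
  part contributes.\<close>

lemma has_integral_poisson_square:
  fixes y :: real
  assumes "y > 0"
  shows "((\<lambda>k. (sinh y)\<^sup>2 / (cosh y - cos k)\<^sup>2) has_integral 2 * pi * coth y) {0..2 * pi}"
proof -
  have "((\<lambda>k. (sinh y)\<^sup>2 / (cosh y - cos k)\<^sup>2) has_integral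
      (sin (2 * pi) / (cosh y - cos (2 * pi)) + cosh y / sinh y *
         (2 * pi + 2 * arctan (exp (- y) * sin (2 * pi) / (1 - exp (- y) * cos (2 * pi))))) -
      (sin 0 / (cosh y - cos 0) + cosh y / sinh y *
         (0 + 2 * arctan (exp (- y) * sin 0 / (1 - exp (- y) * cos 0))))) {0..2 * pi}"
    by (intro fundamental_theorem_of_calculus
        poisson_square_antideriv[OF assms, THEN has_real_derivative_iff_has_vector_derivative[THEN iffD1]]) simp
  then show ?thesis by (simp add: coth_def mult.commute)
qed

section \<open>The Blaschke factor\<close>

text \<open>Up to sign, the Blaschke factor of the unit disc in \<open>u = exp (\<i> * z)\<close>
  with zero \<open>q = exp (- y)\<close>. The upper half plane corresponds to 0 < |u| < 1.\<close>

definition band_phase :: "real \<Rightarrow> complex \<Rightarrow> complex" where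
  "band_phase y z = (exp (\<i> * z) - exp (- of_real y)) / (exp (- of_real y) * exp (\<i> * z) - 1)"

text \<open>The hypothesis avoids the pole of \<open>band_phase\<close>, where division by zero
  would return 0.\<close>

lemma one_minus_cos_shift:
  assumes "exp (- complex_of_real y) * exp (\<i> * z) \<noteq> 1"
  shows "1 - cos (z - \<i> * of_real y) = (cosh (of_real y) - cos z) * band_phase y z"
proof -
  define u q where "u = exp (\<i> * z)" and "q = exp (- complex_of_real y)"
  have nz: "u \<noteq> 0" "q \<noteq> 0" by (auto simp: u_def q_def)
  have e: "exp (\<i> * (z - \<i> * of_real y)) = u / q" "exp (- (\<i> * (z - \<i> * of_real y))) = q / u"
    "exp (- (\<i> * z)) = 1 / u" "exp (complex_of_real y) = 1 / q"
    by (simp_all add: u_def q_def algebra_simps exp_add exp_diff exp_minus field_simps)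
  have "q * u - 1 \<noteq> 0" using assms by (simp add: u_def q_def)
  then show ?thesis
    unfolding cos_exp_eq cosh_field_def band_phase_def e u_def[symmetric] q_def[symmetric]
    using nz by (simp add: field_simps)
qed

text \<open>Mirror image of the previous identity: replacing y by -y inverts
  \<open>band_phase\<close>. Now its zero has to be avoided.\<close>

lemma one_minus_cos_shift':
  assumes "exp (\<i> * z) \<noteq> exp (- complex_of_real y)"
  shows "1 - cos (z + \<i> * of_real y) = (cosh (of_real y) - cos z) / band_phase y z"
proof -
  define u q where "u = exp (\<i> * z)" and "q = exp (- complex_of_real y)"
  have nz: "u \<noteq> 0" "q \<noteq> 0" by (auto simp: u_def q_def)
  have e: "exp (\<i> * (z + \<i> * of_real y)) = u * q" "exp (- (\<i> * (z + \<i> * of_real y))) = 1 / (q * u)"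
    "exp (- (\<i> * z)) = 1 / u" "exp (complex_of_real y) = 1 / q"
    by (simp_all add: u_def q_def algebra_simps exp_add exp_diff exp_minus field_simps)
  have "u - q \<noteq> 0" using assms by (simp add: u_def q_def)
  then show ?thesis
    unfolding cos_exp_eq cosh_field_def band_phase_def e u_def[symmetric] q_def[symmetric]
    using nz by (simp add: field_simps)
qed

text \<open>For real k, |u| = 1 and |q| < 1, so numerator and denominator are nonzero. Conjugation
  sends u to 1/u and thereby exchanges them up to a common factor.\<close>

lemma band_phase_of_real:
  assumes "y > 0"
  shows "exp (- complex_of_real y) * exp (\<i> * of_real k) \<noteq> 1"
    and "exp (\<i> * of_real k) \<noteq> exp (- complex_of_real y)"
    and "cnj (band_phase y (of_real k)) = 1 / band_phase y (of_real k)"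
    and "band_phase y (of_real k) \<noteq> 0"
proof -
  have n: "norm (exp (- complex_of_real y) * exp (\<i> * of_real k)) < 1"
    using assms by (simp add: norm_mult)
  then show 1: "exp (- complex_of_real y) * exp (\<i> * of_real k) \<noteq> 1" by auto
  have "norm (exp (\<i> * complex_of_real k)) \<noteq> norm (exp (- complex_of_real y))"
    using assms by simp
  then show 2: "exp (\<i> * of_real k) \<noteq> exp (- complex_of_real y)" by metis
  show "band_phase y (of_real k) \<noteq> 0" using 1 2 by (simp add: band_phase_def)
  show "cnj (band_phase y (of_real k)) = 1 / band_phase y (of_real k)"
    using 1 2 by (simp add: band_phase_def exp_cnj exp_minus field_simps)
qed

text \<open>The logarithmic derivative is \<open>\<i> * u * (1 / (u - q) - q / (q * u - 1))\<close>.
  Its combined numerator yields \<open>sinh y\<close>, its denominator the factorisation of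
  \<open>cosh y - cos z\<close>.\<close>

lemma band_phase_field_derivative:
  assumes "exp (- complex_of_real y) * exp (\<i> * z) \<noteq> 1" "cosh (of_real y) \<noteq> cos z"
  shows "(band_phase y has_field_derivative
     \<i> * sinh (of_real y) / (cosh (of_real y) - cos z) * band_phase y z) (at z)"
proof -
  define u q where "u = exp (\<i> * z)" and "q = exp (- complex_of_real y)"
  have nz: "u \<noteq> 0" "q \<noteq> 0" by (auto simp: u_def q_def)
  have e: "exp (- (\<i> * z)) = 1 / u" "exp (complex_of_real y) = 1 / q"
    by (simp_all add: u_def q_def exp_minus field_simps)
  have n1: "q * u - 1 \<noteq> 0" using assms by (simp add: u_def q_def)
  have D: "cosh (of_real y) - cos z = (u - q) * (1 - q * u) / (2 * q * u)"
    unfolding cos_exp_eq cosh_field_def e u_def[symmetric] q_def[symmetric]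
    using nz by (simp add: field_simps)
  have S: "sinh (of_real y) = (1 - q\<^sup>2) / (2 * q)"
    unfolding sinh_field_def e q_def[symmetric]
    using nz by (simp add: field_simps power2_eq_square)
  have n2: "u - q \<noteq> 0" using assms(2) D by auto
  have "(band_phase y has_field_derivative
     (\<i> * u * (q * u - 1) - (u - q) * (q * (\<i> * u))) / ((q * u - 1) * (q * u - 1))) (at z)"
    unfolding band_phase_def[abs_def] u_def q_def using assms(1)
    by (auto intro!: derivative_eq_intros)
  also have "(\<i> * u * (q * u - 1) - (u - q) * (q * (\<i> * u))) / ((q * u - 1) * (q * u - 1)) =
     \<i> * ((1 - q\<^sup>2) / (2 * q)) / ((u - q) * (1 - q * u) / (2 * q * u)) * ((u - q) / (q * u - 1))"
  proof -
    have "1 - q * u = - (q * u - 1)" by simp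
    then show ?thesis using nz n1 n2
      by (simp add: divide_simps) (simp add: algebra_simps power2_eq_square)
  qed
  finally show ?thesis unfolding D S band_phase_def u_def q_def .
qed

lemma band_phase_vector_derivative:
  assumes "y > 0"
  shows "((\<lambda>k. band_phase y (of_real k)) has_vector_derivative
     \<i> * of_real (sinh y / (cosh y - cos k)) * band_phase y (of_real k)) (at k)"
proof -
  have "complex_of_real (cosh y - cos k) \<noteq> 0"
    using cosh_minus_cos_pos[OF assms, of k] by (simp only: of_real_eq_0_iff)
  then have "cosh (complex_of_real y) \<noteq> cos (of_real k)" by (simp add: cosh_of_real cos_of_real)
  from has_vector_derivative_real_field[OF
      band_phase_field_derivative[OF band_phase_of_real(1)[OF assms] this]]
  show ?thesis by (simp add: cosh_of_real sinh_of_real cos_of_real)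
qed

lemma band_phase_meromorphic: "band_phase y meromorphic_on A"
  unfolding band_phase_def[abs_def]
  by (intro meromorphic_intros analytic_on_imp_meromorphic_on analytic_intros)

lemma band_phase_no_pole:
  assumes "y > 0" "Im z > 0"
  shows "\<not> is_pole (band_phase y) z"
proof (rule analytic_at_imp_no_pole)
  have "norm (exp (- complex_of_real y) * exp (\<i> * z)) < 1"
    using assms by (simp add: norm_mult flip: exp_add)
  then have "exp (- complex_of_real y) * exp (\<i> * z) \<noteq> 1" by auto
  then show "band_phase y analytic_on {z}"
    unfolding band_phase_def[abs_def] by (intro analytic_intros) auto
qed

lemma inverse_band_phase_eq:
  "1 / band_phase y z =
    (exp (- of_real y) * exp (\<i> * z) - 1) / (exp (\<i> * z) - exp (- of_real y))"
  by (simp add: band_phase_def)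

text \<open>A pole forces \<open>exp (\<i> * z) = exp (- y)\<close>; comparing moduli gives the
  height.\<close>

lemma inverse_band_phase_pole_Im:
  assumes "is_pole (\<lambda>z. 1 / band_phase y z) z"
  shows "Im z = y"
proof (rule ccontr)
  assume "Im z \<noteq> y"
  then have "norm (exp (\<i> * z)) \<noteq> norm (exp (- complex_of_real y))" by simp
  then have "exp (\<i> * z) \<noteq> exp (- complex_of_real y)" by metis
  then have "(\<lambda>z. 1 / band_phase y z) analytic_on {z}"
    unfolding inverse_band_phase_eq by (intro analytic_intros) auto
  with assms show False using analytic_at_imp_no_pole by blast
qed

text \<open>At this point the numerator is \<open>exp (- 2 * y) - 1\<close>, which is nonzero, while
  the denominator has an isolated zero.\<close>

lemma inverse_band_phase_pole:
  assumes "y > 0"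
  shows "is_pole (\<lambda>z. 1 / band_phase y z) (\<i> * of_real y)"
  unfolding inverse_band_phase_eq
proof (rule is_pole_divide)
  show "isCont (\<lambda>z. exp (- of_real y) * exp (\<i> * z) - 1) (\<i> * of_real y)"
    by (intro continuous_intros)
  have "\<forall>\<^sub>F z in at (\<i> * of_real y). exp (\<i> * z) - exp (- of_real y) \<noteq> 0"
    unfolding eventually_at
  proof (intro exI[of _ 1] conjI ballI impI notI)
    fix z assume z: "z \<noteq> \<i> * of_real y \<and> dist z (\<i> * of_real y) < 1"
      and "exp (\<i> * z) - exp (- of_real y) = 0"
    then have "exp (\<i> * z) = exp (- of_real y)" by simp
    \<comment> \<open>The exponential is injective on pairs whose imaginary parts differ by less
      than \<open>2 * pi\<close>; the radius 1 guarantees this.\<close>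
    moreover have "\<bar>Im (\<i> * z) - Im (- complex_of_real y)\<bar> < 2 * pi"
      using abs_Re_le_cmod[of "z - \<i> * of_real y"] z pi_gt3 by (simp add: dist_norm)
    ultimately have "\<i> * z = - of_real y" by (rule exp_complex_eqI[rotated])
    then have "\<i> * (\<i> * z) = \<i> * (- of_real y)" by simp
    then show False using z by simp
  qed simp
  then show "filterlim (\<lambda>z. exp (\<i> * z) - exp (- of_real y)) (at 0) (at (\<i> * of_real y))"
    by (intro filterlim_atI) (auto intro!: tendsto_eq_intros)
  have "norm (exp (- complex_of_real y) * exp (\<i> * (\<i> * of_real y))) < 1"
    using assms by (simp add: norm_mult flip: exp_add)
  then show "exp (- complex_of_real y) * exp (\<i> * (\<i> * of_real y)) - 1 \<noteq> 0" by auto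
qed

section \<open>Rank-one matrices and their kernel projection\<close>

text \<open>For |f| = 1 this is the orthogonal projection onto the line through (f, -1). Writing
  \<open>1 / f\<close> in place of \<open>cnj f\<close> makes it meromorphic in f, so the same
  formula also gives the extension to complex k.\<close>

definition flat_band_matrix :: "complex \<Rightarrow> complex^2^2" where
  "flat_band_matrix f = vector [vector [1/2, - f/2], vector [- (1 / f) / 2, 1/2]]"

lemma flat_band_matrix_nth:
  "flat_band_matrix f $ 1 $ 1 = 1/2" "flat_band_matrix f $ 2 $ 2 = 1/2"
  "flat_band_matrix f $ 1 $ 2 = - f/2" "flat_band_matrix f $ 2 $ 1 = - (1 / f)/2"
  by (simp_all add: flat_band_matrix_def)

text \<open>The difference of the two images of a vector lies in the kernel and is orthogonal to the
  kernel, hence to itself. This justifies the definite description in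
  \<open>orth_projection\<close>.\<close>

lemma is_orth_projection_unique:
  assumes P: "is_orth_projection P (ker A)" and Q: "is_orth_projection Q (ker A)"
  shows "P = Q"
proof -
  have "P *v v = Q *v v" for v
  proof -
    define w where "w = P *v v - Q *v v"
    have "w \<in> ker A"
      using P Q by (simp add: is_orth_projection_def ker_def w_def matrix_vector_mult_diff_distrib)
    then have "cinner w (v - Q *v v) - cinner w (v - P *v v) = 0"
      using P Q by (simp add: is_orth_projection_def)
    then have "(\<Sum>i\<in>UNIV. cnj (w $ i) * w $ i) = 0"
      by (simp add: cinner_def w_def sum_subtractf[symmetric] algebra_simps)
    also have "(\<Sum>i\<in>UNIV. cnj (w $ i) * w $ i) = of_real (\<Sum>i\<in>UNIV. (cmod (w $ i))\<^sup>2)"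
      by (simp only: of_real_sum complex_norm_square mult.commute)
    finally have "(\<Sum>i\<in>UNIV. (cmod (w $ i))\<^sup>2) = 0" by (simp only: of_real_eq_0_iff)
    then have "w = 0" by (simp add: sum_nonneg_eq_0_iff vec_eq_iff)
    then show ?thesis by (simp add: w_def)
  qed
  then show ?thesis by (simp add: matrix_eq)
qed

lemma orth_projection_ker:
  assumes "is_orth_projection P (ker A)"
  shows "orth_projection (ker A) = P"
  unfolding orth_projection_def using assms is_orth_projection_unique by blast

context
  fixes M :: "complex^2^2" and e f :: complex
  assumes M: "M $ 1 $ 1 = e" "M $ 2 $ 2 = e" "M $ 1 $ 2 = e * f" "M $ 2 $ 1 = e / f"
    and e: "e \<noteq> 0" and f: "f \<noteq> 0"
begin

text \<open>M is e times the column (1, 1/f) times the row (1, f), so it sees a vector only through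
  \<open>v $ 1 + f * v $ 2\<close>.\<close>

lemma rank_one_mult_vec:
  "(M *v v) $ 1 = e * (v $ 1 + f * v $ 2)" "(M *v v) $ 2 = e * (v $ 1 + f * v $ 2) / f"
  using f by (simp_all add: matrix_vector_mult_def sum_2 M field_simps)

lemma rank_one_ker: "ker M = {v. v $ 1 + f * v $ 2 = 0}"
  using e f by (auto simp: ker_def vec_eq_iff forall_2 rank_one_mult_vec)

lemma rank_one_eigenvalues: "eigenvalues M = {0, 2 * e}"
proof (intro equalityI subsetI)
  fix \<mu> assume "\<mu> \<in> eigenvalues M"
  then obtain v where v: "v \<noteq> 0" "M *v v = \<mu> *s v" by (auto simp: eigenvalues_def)
  define s where "s = v $ 1 + f * v $ 2"
  \<comment> \<open>Adding the two equations gives \<open>2 * e * s = \<mu> * s\<close>.\<close>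
  have 1: "e * s = \<mu> * v $ 1" "e * s = \<mu> * (f * v $ 2)"
    using v(2) f by (auto simp: vec_eq_iff forall_2 rank_one_mult_vec s_def field_simps)
  then have "(2 * e - \<mu>) * s = 0" unfolding s_def by algebra
  moreover have "\<mu> = 0" if "s = 0"
    using that 1 v(1) f by (auto simp: vec_eq_iff forall_2)
  ultimately show "\<mu> \<in> {0, 2 * e}" by auto
next
  fix \<mu> assume "\<mu> \<in> {0, 2 * e}"
  \<comment> \<open>(f, -1) is annihilated by the row (1, f), and (f, 1) is a multiple of the column
    (1, 1/f).\<close>
  moreover have "M *v vector [f, -1] = 0 *s vector [f, -1]" "vector [f, -1] \<noteq> (0 :: complex^2)"
    by (auto simp: vec_eq_iff forall_2 rank_one_mult_vec)
  moreover have "M *v vector [f, 1] = (2 * e) *s vector [f, 1]" "vector [f, 1] \<noteq> (0 :: complex^2)"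
    using f by (auto simp: vec_eq_iff forall_2 rank_one_mult_vec)
  ultimately show "\<mu> \<in> eigenvalues M" unfolding eigenvalues_def by blast
qed

lemma rank_one_dim_eigenspace: "vec.dim (eigenspace M 0) = 1"
proof -
  have "eigenspace M 0 = ker M" by (simp add: eigenspace_def ker_def)
  also have "\<dots> = vec.span {vector [f, -1]}"
    unfolding rank_one_ker vec.span_singleton
  proof (intro equalityI subsetI)
    fix v :: "complex^2" assume "v \<in> {v. v $ 1 + f * v $ 2 = 0}"
    then have "v = (- (v $ 2)) *s vector [f, -1]"
      by (simp add: vec_eq_iff forall_2 add_eq_0_iff2 mult.commute)
    then show "v \<in> range (\<lambda>k. k *s vector [f, -1])" by blast
  qed auto
  finally show ?thesis by (simp add: vec.dim_span) (auto simp: vec_eq_iff forall_2)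
qed

text \<open>The kernel consists of multiples of (f, -1), and
  \<open>v - flat_band_matrix f *v v\<close> is a multiple of (f, 1). Their inner product is a
  multiple of |f|^2 - 1, which vanishes for unimodular f.\<close>

lemma rank_one_orth_projection:
  assumes "cnj f = 1 / f"
  shows "is_orth_projection (flat_band_matrix f) (ker M)"
  unfolding is_orth_projection_def rank_one_ker
proof (intro allI conjI ballI)
  fix v w :: "complex^2" assume "w \<in> {v. v $ 1 + f * v $ 2 = 0}"
  then have w: "w $ 1 = - f * w $ 2" by (simp add: add_eq_0_iff2)
  show "cinner w (v - flat_band_matrix f *v v) = 0"
    using f by (simp add: cinner_def sum_2 matrix_vector_mult_def flat_band_matrix_nth w assms field_simps)
qed (use f in \<open>simp add: sum_2 matrix_vector_mult_def flat_band_matrix_nth field_simps\<close>)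

end

section \<open>The projection as a function of k: derivative, meromorphy, rationality\<close>

lemma flat_band_matrix_vector_derivative:
  assumes "y > 0"
  defines "r \<equiv> \<lambda>k. \<i> * complex_of_real (sinh y / (cosh y - cos k))"
  shows "((\<lambda>k. flat_band_matrix (band_phase y (of_real k))) has_vector_derivative
     vector [vector [0, - (r k * band_phase y (of_real k)) / 2],
             vector [(r k / band_phase y (of_real k)) / 2, 0]]) (at k)"
proof (intro has_vector_derivative_vec)
  fix i j :: 2
  have 1: "((\<lambda>k. band_phase y (of_real k)) has_vector_derivative r k * band_phase y (of_real k)) (at k)"
    unfolding r_def by (rule band_phase_vector_derivative[OF assms(1)])
  note 2 = has_vector_derivative_inverse_logarithmic[OF 1 band_phase_of_real(4)[OF assms(1)]]
  show "((\<lambda>k. flat_band_matrix (band_phase y (of_real k)) $ i $ j) has_vector_derivative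
     (vector [vector [0, - (r k * band_phase y (of_real k)) / 2],
             vector [(r k / band_phase y (of_real k)) / 2, 0]] :: complex^2^2) $ i $ j) (at k)"
    using exhaust_2[of i] exhaust_2[of j] has_vector_derivative_divide[OF has_vector_derivative_minus[OF 1], of 2]
       has_vector_derivative_divide[OF has_vector_derivative_minus[OF 2], of 2]
    by (elim disjE) (simp_all add: flat_band_matrix_nth)
qed

lemma flat_band_matrix_meromorphic:
  "(\<lambda>z. flat_band_matrix (band_phase y z) $ i $ j) meromorphic_on UNIV"
  using exhaust_2[of i] exhaust_2[of j]
  by (elim disjE) (auto simp: flat_band_matrix_nth intro!: meromorphic_intros band_phase_meromorphic)

lemma flat_band_matrix_rational: "rational_in_exp (\<lambda>z. flat_band_matrix (band_phase y z))"
  unfolding rational_in_exp_def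
proof (intro allI)
  fix i j :: 2
  define q where "q = exp (- complex_of_real y)"
  have "q \<noteq> 0" by (simp add: q_def)
  consider "i = j" | "i = 1" "j = 2" | "i = 2" "j = 1"
    using exhaust_2[of i] exhaust_2[of j] by blast
  then show "\<exists>a b :: complex poly. b \<noteq> 0 \<and> (\<forall>z. flat_band_matrix (band_phase y z) $ i $ j =
      poly a (exp (\<i> * z)) / poly b (exp (\<i> * z)))"
  proof cases
    case 1
    then show ?thesis using exhaust_2[of i]
      by (intro exI[of _ "[:1/2:]"] exI[of _ 1]) (auto simp: flat_band_matrix_nth)
  next
    case 2
    then show ?thesis using \<open>q \<noteq> 0\<close>
      \<comment> \<open>Coefficients in ascending powers of \<open>exp (\<i> * z)\<close>, read off
        from \<open>- band_phase y z / 2\<close>.\<close>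
      by (intro exI[of _ "[:q/2, -1/2:]"] exI[of _ "[:-1, q:]"])
        (auto simp: flat_band_matrix_nth band_phase_def q_def[symmetric] diff_divide_distrib algebra_simps)
  next
    case 3
    then show ?thesis
      by (intro exI[of _ "[:1/2, -q/2:]"] exI[of _ "[:-q, 1:]"])
        (auto simp: flat_band_matrix_nth inverse_band_phase_eq q_def[symmetric] diff_divide_distrib algebra_simps)
  qed
qed

section \<open>The Hamiltonian\<close>

lemma hops_within_1I:
  fixes H :: "real \<Rightarrow> complex^'n^'n"
  assumes "\<And>i j. \<exists>a b c. \<forall>k::real. H k $ i $ j = a * exp (\<i> * of_real k) + b + c * exp (- (\<i> * of_real k))"
  shows "hops_within H 1"
proof -
  obtain a b c where abc: "\<And>i j k. H k $ i $ j =
      a i j * exp (\<i> * of_real k) + b i j + c i j * exp (- (\<i> * of_real k))"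
    using assms by metis
  have "{- int 1..int 1} = {-1, 0, 1}" by auto
  then show ?thesis unfolding hops_within_def
    by (intro exI[of _ "\<lambda>l. \<chi> i j. if l = 1 then a i j else if l = 0 then b i j else c i j"])
      (simp add: abc)
qed

lemma hops_within_0_const:
  fixes H :: "real \<Rightarrow> complex^'n^'n"
  assumes "hops_within H 0" shows "H k $ i $ j = H l $ i $ j"
  using assms by (auto simp: hops_within_def)

lemma H1_nth:
  fixes C y :: real
  assumes "y > 0"
  defines "e \<equiv> \<lambda>k. complex_of_real (C * (cosh y - cos k))"
  shows "H1 C y k $ 1 $ 1 = e k" "H1 C y k $ 2 $ 2 = e k"
    "H1 C y k $ 1 $ 2 = e k * band_phase y (of_real k)"
    "H1 C y k $ 2 $ 1 = e k / band_phase y (of_real k)"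
proof -
  have D: "cosh (complex_of_real y) - cos (of_real k) = of_real (cosh y - cos k)"
    by (simp add: cosh_of_real cos_of_real)
  show "H1 C y k $ 1 $ 1 = e k" "H1 C y k $ 2 $ 2 = e k"
    unfolding H1_def Let_def e_def vector_2 D of_real_mult by (rule refl)+
  show "H1 C y k $ 1 $ 2 = e k * band_phase y (of_real k)"
    using one_minus_cos_shift[OF band_phase_of_real(1)[OF assms(1)], of k]
    unfolding H1_def Let_def e_def vector_2 D of_real_mult by (simp only: mult.assoc)
  show "H1 C y k $ 2 $ 1 = e k / band_phase y (of_real k)"
    using one_minus_cos_shift'[OF band_phase_of_real(2)[OF assms(1)], of k]
    unfolding H1_def Let_def e_def vector_2 D of_real_mult by (simp only: times_divide_eq_right)
qed

lemma H1_entries: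
  "\<exists>a b c. \<forall>k::real. H1 C y k $ i $ j = a * exp (\<i> * of_real k) + b + c * exp (- (\<i> * of_real k))"
proof -
  \<comment> \<open>Here q is \<open>exp y\<close>, the reciprocal of the q used for the Blaschke
    factor.\<close>
  define c q where "c = complex_of_real C" and "q = exp (complex_of_real y)"
  have c: "cos (of_real k) = (exp (\<i> * of_real k) + exp (- (\<i> * of_real k))) / 2"
    "cos (of_real k - \<i> * of_real y) = (q * exp (\<i> * of_real k) + exp (- (\<i> * of_real k)) / q) / 2"
    "cos (of_real k + \<i> * of_real y) = (exp (\<i> * of_real k) / q + q * exp (- (\<i> * of_real k))) / 2" for k
    by (simp_all add: cos_exp_eq q_def exp_diff exp_add exp_minus field_simps)
  consider "i = j" | "i = 1" "j = 2" | "i = 2" "j = 1"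
    using exhaust_2[of i] exhaust_2[of j] by blast
  then show ?thesis
  proof cases
    case 1
    then show ?thesis using exhaust_2[of i]
      by (intro exI[of _ "- c / 2"] exI[of _ "c * cosh (of_real y)"])
        (auto simp: H1_def Let_def c c_def field_simps)
  next
    case 2
    then show ?thesis
      by (intro exI[of _ "- c * q / 2"] exI[of _ c] exI[of _ "- c / q / 2"])
        (auto simp: H1_def Let_def c c_def field_simps)
  next
    case 3
    then show ?thesis
      by (intro exI[of _ "- c / q / 2"] exI[of _ c] exI[of _ "- c * q / 2"])
        (auto simp: H1_def Let_def c c_def field_simps)
  qed
qed

lemma H1_hopping_range:
  assumes "C > 0"
  shows "hopping_range (H1 C y) = 1"
  unfolding hopping_range_def
proof (rule Least_equality)
  show "hops_within (H1 C y) 1" by (rule hops_within_1I) (rule H1_entries)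
  fix m assume m: "hops_within (H1 C y) m"
  \<comment> \<open>Range 0 would make every entry constant in k, but the diagonal contains
    \<open>cos k\<close>, which separates 0 from pi.\<close>
  have "H1 C y 0 $ 1 $ 1 \<noteq> H1 C y pi $ 1 $ 1"
    using assms by (simp add: H1_def Let_def cos_of_real)
  then have "m \<noteq> 0" using m hops_within_0_const[of "H1 C y" 0 1 1 pi] by metis
  then show "1 \<le> m" by simp
qed

lemma H1_bloch: "bloch_hamiltonian (H1 C y)"
  unfolding bloch_hamiltonian_def hermitian_def
proof (intro conjI allI)
  fix k and i j :: 2
  show "H1 C y k $ j $ i = cnj (H1 C y k $ i $ j)"
    using exhaust_2[of i] exhaust_2[of j]
    by (elim disjE) (simp_all add: H1_def Let_def cosh_of_real cnj_cos)
next
  fix k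
  have p: "cos (z + 2 * complex_of_real pi) = cos z" for z
    using cos_of_real[of "2 * pi"] sin_of_real[of "2 * pi"] by (simp add: cos_add)
  have "cos (complex_of_real (k + 2 * pi)) = cos (of_real k)"
    "cos (complex_of_real (k + 2 * pi) - \<i> * of_real y) = cos (of_real k - \<i> * of_real y)"
    "cos (complex_of_real (k + 2 * pi) + \<i> * of_real y) = cos (of_real k + \<i> * of_real y)"
    using p[of "of_real k"] p[of "of_real k - \<i> * of_real y"] p[of "of_real k + \<i> * of_real y"]
    by (simp_all add: algebra_simps)
  then show "H1 C y (k + 2 * pi) = H1 C y k" unfolding H1_def Let_def by (simp only:)
qed

section \<open>Spectrum, quantum metric and poles of the flat band\<close>

context
  fixes C y0 :: real
  assumes C: "C > 0" and y0: "y0 > 0"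
begin

lemma H1_rank_one:
  fixes k :: real
  defines "e \<equiv> complex_of_real (C * (cosh y0 - cos k))" and "f \<equiv> band_phase y0 (of_real k)"
  shows "H1 C y0 k $ 1 $ 1 = e" "H1 C y0 k $ 2 $ 2 = e" "H1 C y0 k $ 1 $ 2 = e * f" "H1 C y0 k $ 2 $ 1 = e / f"
     "e \<noteq> 0" "f \<noteq> 0"
proof -
  have "C * (cosh y0 - cos k) \<noteq> 0" using C cosh_minus_cos_pos[OF y0, of k] by simp
  then show "e \<noteq> 0" unfolding e_def of_real_eq_0_iff .
qed (use H1_nth[OF y0] band_phase_of_real(4)[OF y0] in \<open>simp_all only: e_def f_def not_False_eq_True\<close>)

lemma H1_orth_projection:
  "is_orth_projection (flat_band_matrix (band_phase y0 (of_real k))) (ker (H1 C y0 k))"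
  by (rule rank_one_orth_projection[OF H1_rank_one band_phase_of_real(3)[OF y0]])

lemma flat_projection_H1:
  "flat_projection (H1 C y0) = (\<lambda>k. flat_band_matrix (band_phase y0 (of_real k)))"
  unfolding flat_projection_def using orth_projection_ker[OF H1_orth_projection] by blast

lemma H1_eigenvalues:
  "eigenvalues (H1 C y0 k) = {of_real 0, of_real (2 * C * (cosh y0 - cos k))}"
proof -
  have "2 * complex_of_real (C * (cosh y0 - cos k)) = of_real (2 * C * (cosh y0 - cos k))" by simp
  then show ?thesis using rank_one_eigenvalues[OF H1_rank_one] by (simp only: of_real_0)
qed

text \<open>The dispersive band has its bottom at k = 0; this value is the uniform gap demanded by
  \<open>isolated_band\<close>.\<close>

lemma dispersive_band_ge: "2 * C * (cosh y0 - cos k) \<ge> 2 * C * (cosh y0 - 1)"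
  using C by simp

lemma H1_isolated_band: "isolated_band (H1 C y0) (\<lambda>k. 0)"
  unfolding isolated_band_def
proof (intro conjI allI exI[of _ "2 * C * (cosh y0 - 1)"] ballI)
  show "vec.dim (eigenspace (H1 C y0 k) (of_real 0)) = 1" for k
    using rank_one_dim_eigenspace[OF H1_rank_one] by simp
  show "2 * C * (cosh y0 - 1) > 0" using C cosh_gt_1[of y0] y0 by simp
  fix k \<mu> assume "\<mu> \<in> eigenvalues (H1 C y0 k) - {of_real 0}"
  then have "\<mu> = of_real (2 * C * (cosh y0 - cos k))" unfolding H1_eigenvalues by blast
  then have "cmod (\<mu> - of_real 0) = \<bar>2 * C * (cosh y0 - cos k)\<bar>"
    by (simp only: of_real_0 diff_zero norm_of_real)
  then show "2 * C * (cosh y0 - 1) \<le> cmod (\<mu> - of_real 0)"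
    using dispersive_band_ge[of k] by linarith
qed

text \<open>The derivative of the projection is purely off-diagonal, and in the product of its two
  entries the phase cancels. Its square is therefore a scalar matrix.\<close>

lemma quantum_metric_H1:
  "quantum_metric (flat_projection (H1 C y0)) k =
     of_real ((sinh y0)\<^sup>2 / (cosh y0 - cos k)\<^sup>2 / 4)"
proof -
  define r where "r = sinh y0 / (cosh y0 - cos k)"
  have "quantum_metric (flat_projection (H1 C y0)) k = - (\<i> * of_real r)\<^sup>2 / 4"
    unfolding quantum_metric_def flat_projection_H1
      vector_derivative_at[OF flat_band_matrix_vector_derivative[OF y0]] r_def[symmetric]
    using band_phase_of_real(4)[OF y0, of k]
    by (simp add: trace_def sum_2 matrix_matrix_mult_def power_mult_distrib) (simp add: power2_eq_square)
  also have "\<dots> = of_real (r\<^sup>2 / 4)" by (simp add: power_mult_distrib)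
  finally show ?thesis by (simp add: r_def power_divide)
qed

lemma quantum_metric_H1_has_integral:
  "(quantum_metric (flat_projection (H1 C y0)) has_integral of_real (2 * pi * coth y0 / 4)) {0..2 * pi}"
  unfolding quantum_metric_H1[abs_def]
  by (intro has_integral_of_real has_integral_divide has_integral_poisson_square y0)

lemma qm_length_H1: "qm_length (flat_projection (H1 C y0)) = of_real (1/4 * coth y0)"
proof -
  have "((\<lambda>k. quantum_metric (flat_projection (H1 C y0)) k / of_real (2 * pi)) has_integral
     of_real (2 * pi * coth y0 / 4) / of_real (2 * pi)) {0..2 * pi}"
    by (intro has_integral_divide quantum_metric_H1_has_integral)
  from integral_unique[OF this] show ?thesis unfolding qm_length_def by (simp only:) simp
qed

lemma H1_meromorphic_extension:
  "is_meromorphic_extension (flat_projection (H1 C y0)) (\<lambda>z. flat_band_matrix (band_phase y0 z))"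
  by (simp add: is_meromorphic_extension_def flat_projection_H1 flat_band_matrix_meromorphic)

text \<open>Passing to the explicit extension leaves three kinds of entries: constants, multiples of
  the Blaschke factor (no upper poles), and multiples of its reciprocal (poles only at height
  \<open>y0\<close>).\<close>

lemma upper_pole_H1_Im:
  assumes "upper_pole (flat_projection (H1 C y0)) z" shows "Im z = y0"
proof -
  obtain Pc :: "complex \<Rightarrow> complex^2^2" and i j where Pc: "is_meromorphic_extension (flat_projection (H1 C y0)) Pc"
    "is_pole (\<lambda>w. Pc w $ i $ j) z" and z: "Im z > 0"
    using assms by (auto simp: upper_pole_def)
  have "is_pole (\<lambda>w. Pc w $ i $ j) z \<longleftrightarrow> is_pole (\<lambda>w. flat_band_matrix (band_phase y0 w) $ i $ j) z"
    using Pc(1) H1_meromorphic_extension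
    by (intro is_pole_iff_if_eq_on_Reals) (auto simp: is_meromorphic_extension_def)
  then have pole: "is_pole (\<lambda>w. flat_band_matrix (band_phase y0 w) $ i $ j) z" using Pc(2) by blast
  consider "i = j" | "i = 1" "j = 2" | "i = 2" "j = 1"
    using exhaust_2[of i] exhaust_2[of j] by blast
  then show ?thesis
  proof cases
    case 1
    then show ?thesis using pole exhaust_2[of i] by (auto simp: flat_band_matrix_nth)
  next
    case 2
    then have "is_pole (\<lambda>w. (- 1/2) * band_phase y0 w) z" using pole by (simp add: flat_band_matrix_nth)
    then have "is_pole (band_phase y0) z" by (subst (asm) is_pole_cmult_iff) auto
    then show ?thesis using band_phase_no_pole[OF y0 z] by blast
  next
    case 3
    then have "is_pole (\<lambda>w. (- 1/2) * (1 / band_phase y0 w)) z" using pole by (simp add: flat_band_matrix_nth mult.commute)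
    then have "is_pole (\<lambda>w. 1 / band_phase y0 w) z" by (subst (asm) is_pole_cmult_iff) auto
    then show ?thesis by (rule inverse_band_phase_pole_Im)
  qed
qed

lemma upper_pole_H1: "upper_pole (flat_projection (H1 C y0)) (\<i> * of_real y0)"
  unfolding upper_pole_def
proof (intro conjI exI)
  show "is_meromorphic_extension (flat_projection (H1 C y0)) (\<lambda>z. flat_band_matrix (band_phase y0 z))"
    by (rule H1_meromorphic_extension)
  have "is_pole (\<lambda>w. (- 1/2) * (1 / band_phase y0 w)) (\<i> * of_real y0)"
    using inverse_band_phase_pole[OF y0] by (subst is_pole_cmult_iff) auto
  then show "is_pole (\<lambda>w. flat_band_matrix (band_phase y0 w) $ 2 $ 1) (\<i> * of_real y0)"
    by (simp add: flat_band_matrix_nth mult.commute)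
qed (use y0 in simp)

text \<open>All upper poles lie at one height and at least one exists, so the infimum is over a
  singleton and does not take a default value.\<close>

lemma y_min_H1: "y_min (flat_projection (H1 C y0)) = y0"
proof -
  have "Im ` {z. upper_pole (flat_projection (H1 C y0)) z} = {y0}"
    using upper_pole_H1_Im upper_pole_H1 by force
  then show ?thesis by (simp add: y_min_def)
qed

end

lemma dispersive_band_nonconstant:
  assumes "C > 0"
  shows "\<not> (\<lambda>k. 2 * C * (cosh y - cos k)) constant_on (UNIV :: real set)"
proof
  assume "(\<lambda>k. 2 * C * (cosh y - cos k)) constant_on (UNIV :: real set)"
  then have "2 * C * (cosh y - cos 0) = 2 * C * (cosh y - cos pi)"
    unfolding constant_on_def by (metis UNIV_I)
  with assms show False by simp
qed

theorem mainTheorem2: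
  fixes C y0 :: real
  assumes "C > 0" and "y0 > 0"
  shows
    "let H = H1 C y0;
         P\<^sub>f = flat_projection H;
         E\<^sub>f = (\<lambda>k::real. 0::real);
         E\<^sub>1 = (\<lambda>k. 2 * C * (cosh y0 - cos k));
         N = N_bound H
     in
      (bloch_hamiltonian H \<and> number_of_bands H = 2 \<and>
       hops_within H (hopping_range H) \<and> hopping_range H = 1) \<and>
      \<comment> \<open>(i)\<close>
      (\<forall>i j. \<exists>a b c :: complex. \<forall>k::real.
         H k $ i $ j = a * exp (\<i> * of_real k) + b + c * exp (- (\<i> * of_real k))) \<and>
      \<comment> \<open>(ii)\<close>
      (\<forall>k. eigenvalues (H k) = {of_real (E\<^sub>f k), of_real (E\<^sub>1 k)}) \<and>
      (\<forall>k. E\<^sub>1 k > 0) \<and>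
      \<not> E\<^sub>1 constant_on UNIV \<and>
      isolated_band H E\<^sub>f \<and>
      \<comment> \<open>(iii), preceded by the well-definedness of the objects involved\<close>
      (\<forall>k. \<exists>!P. is_orth_projection P (ker (H k))) \<and>
      (\<forall>k. P\<^sub>f differentiable (at k)) \<and>
      quantum_metric P\<^sub>f integrable_on {0..2 * pi} \<and>
      (\<exists>P\<^sub>c. is_meromorphic_extension P\<^sub>f P\<^sub>c \<and> rational_in_exp P\<^sub>c) \<and>
      qm_length P\<^sub>f = of_real (1/4 * coth y0) \<and>
      (\<exists>z. is_arg_min Im (upper_pole P\<^sub>f) z \<and> Im z = y0) \<and>
      y_min P\<^sub>f = y0 \<and>
      N = 1 \<and>
      qm_length P\<^sub>f = of_real (real N ^ 2 / 4 * coth (y_min P\<^sub>f))"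
  unfolding Let_def
proof (intro conjI)
  show N: "N_bound (H1 C y0) = 1"
    by (simp add: N_bound_def number_of_bands_def H1_hopping_range[OF assms(1)])
  show "hops_within (H1 C y0) (hopping_range (H1 C y0))"
    unfolding H1_hopping_range[OF assms(1)] by (intro hops_within_1I H1_entries)
  show "\<forall>k. 2 * C * (cosh y0 - cos k) > 0"
    using assms(1) cosh_minus_cos_pos[OF assms(2)] by simp
  show "\<forall>k. \<exists>!P. is_orth_projection P (ker (H1 C y0 k))"
    using H1_orth_projection[OF assms] is_orth_projection_unique by blast
  show "\<forall>k. flat_projection (H1 C y0) differentiable (at k)"
    unfolding flat_projection_H1[OF assms]
    using flat_band_matrix_vector_derivative[OF assms(2), THEN differentiableI_vector] by blast
  show "\<exists>P\<^sub>c. is_meromorphic_extension (flat_projection (H1 C y0)) P\<^sub>c \<and> rational_in_exp P\<^sub>c"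
    using H1_meromorphic_extension[OF assms] flat_band_matrix_rational by blast
  show "\<exists>z. is_arg_min Im (upper_pole (flat_projection (H1 C y0))) z \<and> Im z = y0"
    using upper_pole_H1[OF assms] upper_pole_H1_Im[OF assms]
    by (intro exI[of _ "\<i> * of_real y0"]) (force simp: is_arg_min_def)
  show "qm_length (flat_projection (H1 C y0)) =
      of_real (real (N_bound (H1 C y0)) ^ 2 / 4 * coth (y_min (flat_projection (H1 C y0))))"
    unfolding N y_min_H1[OF assms] qm_length_H1[OF assms] by simp
  show "\<not> (\<lambda>k. 2 * C * (cosh y0 - cos k)) constant_on UNIV"
    by (rule dispersive_band_nonconstant[OF assms(1)])
  show "quantum_metric (flat_projection (H1 C y0)) integrable_on {0..2 * pi}"
    using quantum_metric_H1_has_integral[OF assms] by blast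
  show "\<forall>k. eigenvalues (H1 C y0 k) = {of_real 0, of_real (2 * C * (cosh y0 - cos k))}"
    using H1_eigenvalues[OF assms] by blast
qed (simp_all add: H1_bloch number_of_bands_def H1_hopping_range[OF assms(1)] H1_entries
    H1_isolated_band[OF assms] qm_length_H1[OF assms] y_min_H1[OF assms])

end
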